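(* Let $m_{p/q}$ denote the Markov number indexed by the reduced fraction $p/q\in(0,1)$ (as described in the context). Then: (1) (Fixed numerator) For all positive integers $p,q,i$ with $p<q$, $\gcd(q,p)=1$ and $\gcd(q+i,p)=1$, we have $m_{p/q}<m_{p/(q+i)}$. (2) (Fixed denominator) For all positive integers $p,q,i$ with $p+i<q$, $\gcd(q,p)=1$ and $\gcd(q,p+i)=1$, we have $m_{p/q}<m_{(p+i)/q}$.
   Context: A Markov number is any entry of a triple $(x,y,z)$ of positive integers satisfying $x^2+y^2+z^2=3xyz$. The Markov tree is the infinite binary tree with root $(1,5,2)$ in which a vertex $(x,y,z)$ has left child $(x,3xy-z,y)$ and right child $(y,3yz-x,z)$. The Farey tree is the binary tree with root $(\tfrac01,\tfrac12,\tfrac11)$ in which a vertex $(\tfrac ab,\tfrac{a+c}{b+d},\tfrac cd)$ has left child $(\tfrac ab,\tfrac{2a+c}{2b+d},\tfrac{a+c}{b+d})$ and right child $(\tfrac{a+c}{b+d},\tfrac{a+2c}{b+2d},\tfrac cd)$. The two trees have the same shape. Indexing: $m_{0/1}=1$, $m_{1/1}=2$, and for every vertex of the Farey tree, if its middle entry is the reduced fraction $p/q$, then $m_{p/q}$ is the middle entry of the vertex in the same position of the Markov tree (e.g. $m_{1/2}=5$, $m_{1/3}=13$, $m_{2/3}=29$). Every reduced fraction $p/q$ with $0<p<q$ occurs exactly once as a middle entry of the Farey tree. *)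

theory Defs
  imports Complex_Main
begin

text \<open>A position in the infinite binary tree is the list of turns taken from the root, first turn
  first; both trees are maps from positions to vertices, so ``the same position'' is literal.\<close>

datatype turn = L | R

type_synonym markov_vertex = "int \<times> int \<times> int"

fun markov_child :: "markov_vertex \<Rightarrow> turn \<Rightarrow> markov_vertex" where
  "markov_child (x, y, z) L = (x, 3 * x * y - z, y)"
| "markov_child (x, y, z) R = (y, 3 * y * z - x, z)"

definition markov_tree :: "turn list \<Rightarrow> markov_vertex" where
  "markov_tree w = foldl markov_child (1, 5, 2) w"

text \<open>A fraction \<open>a/b\<close> is the pair \<open>(a, b)\<close>. The middle entry of a vertex is the mediant of the
  outer ones and is always in lowest terms (\<open>farey_middle_reduced\<close> below).\<close>

type_synonym fraction = "nat \<times> nat"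
type_synonym farey_vertex = "fraction \<times> fraction \<times> fraction"

fun farey_child :: "farey_vertex \<Rightarrow> turn \<Rightarrow> farey_vertex" where
  "farey_child ((a, b), _, (c, d)) L = ((a, b), (2 * a + c, 2 * b + d), (a + c, b + d))"
| "farey_child ((a, b), _, (c, d)) R = ((a + c, b + d), (a + 2 * c, b + 2 * d), (c, d))"

definition farey_tree :: "turn list \<Rightarrow> farey_vertex" where
  "farey_tree w = foldl farey_child ((0, 1), (1, 2), (1, 1)) w"

definition middle :: "'a \<times> 'a \<times> 'a \<Rightarrow> 'a" where
  "middle v = fst (snd v)"

text \<open>Meaningful for \<open>(p, q) = (0, 1)\<close>, \<open>(1, 1)\<close>, and for coprime \<open>0 < p < q\<close>; in the last case
  the position is unique by \<open>farey_middle_ex1\<close> below.\<close>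

definition markov_num :: "nat \<Rightarrow> nat \<Rightarrow> int" where
  "markov_num p q =
     (if (p, q) = (0, 1) then 1
      else if (p, q) = (1, 1) then 2
      else middle (markov_tree (THE w. middle (farey_tree w) = (p, q))))"

subsection \<open>Well-definedness\<close>

fun mediant_weights :: "turn list \<Rightarrow> nat \<times> nat" where
  "mediant_weights [] = (1, 1)"
| "mediant_weights (L # w) = (case mediant_weights w of (s, t) \<Rightarrow> (s + t, t))"
| "mediant_weights (R # w) = (case mediant_weights w of (s, t) \<Rightarrow> (s, s + t))"

lemma middle_foldl_farey_child:
  "middle (foldl farey_child ((a, b), (a + c, b + d), (c, d)) w) =
    (case mediant_weights w of (s, t) \<Rightarrow> (a * s + c * t, b * s + d * t))"
proof (induction w arbitrary: a b c d)
  case Nil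
  then show ?case by (simp add: middle_def)
next
  case (Cons x w)
  show ?case
  proof (cases x)
    case L
    show ?thesis using Cons.IH[of a b "a + c" "b + d"]
      by (simp add: L algebra_simps mult_2 mult_2_right split: prod.splits)
  next
    case R
    show ?thesis using Cons.IH[of "a + c" "b + d" c d]
      by (simp add: R algebra_simps mult_2 mult_2_right split: prod.splits)
  qed
qed

lemma middle_farey_tree:
  "middle (farey_tree w) = (case mediant_weights w of (s, t) \<Rightarrow> (t, s + t))"
  using middle_foldl_farey_child[of 0 1 1 1 w]
  by (simp add: farey_tree_def numeral_2_eq_2 split: prod.splits)

lemma mediant_weights_coprime:
  "mediant_weights w = (s, t) \<Longrightarrow> 0 < s \<and> 0 < t \<and> coprime s t"
proof (induction w arbitrary: s t rule: mediant_weights.induct)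
  case 1
  then show ?case by auto
next
  case (2 w)
  then show ?case
    by (auto simp: coprime_iff_gcd_eq_1 split: prod.splits)
next
  case (3 w)
  then show ?case
    by (auto simp: coprime_iff_gcd_eq_1 split: prod.splits)
qed

lemma mediant_weights_surj:
  "0 < s \<Longrightarrow> 0 < t \<Longrightarrow> coprime s t \<Longrightarrow> \<exists>w. mediant_weights w = (s, t)"
proof (induction "s + t" arbitrary: s t rule: less_induct)
  case less
  consider "s = t" | "s < t" | "t < s" by linarith
  then show ?case
  proof cases
    case 1
    then have "mediant_weights [] = (s, t)" using less.prems by simp
    then show ?thesis by blast
  next
    case 2
    then have "coprime s (t - s)" using less.prems(3)
      by (metis coprime_iff_gcd_eq_1 gcd.commute gcd_diff1_nat less_imp_le)
    then obtain w where "mediant_weights w = (s, t - s)"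
      using less.hyps[of s "t - s"] 2 less.prems by auto
    then have "mediant_weights (R # w) = (s, t)" using 2 by simp
    then show ?thesis by blast
  next
    case 3
    then have "coprime (s - t) t" using less.prems(3)
      by (metis coprime_iff_gcd_eq_1 gcd_diff1_nat less_imp_le)
    then obtain w where "mediant_weights w = (s - t, t)"
      using less.hyps[of "s - t" t] 3 less.prems by auto
    then have "mediant_weights (L # w) = (s, t)" using 3 by simp
    then show ?thesis by blast
  qed
qed

lemma mediant_weights_inj:
  "mediant_weights v = mediant_weights w \<Longrightarrow> v = w"
proof (induction v arbitrary: w)
  case Nil
  obtain s t where "mediant_weights (tl w) = (s, t)" by fastforce
  then show ?case using Nil mediant_weights_coprime[of "tl w" s t]
    by (cases w rule: mediant_weights.cases) auto
next
  case (Cons x v)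
  obtain s t where st: "mediant_weights v = (s, t)" by fastforce
  obtain s' t' where st': "mediant_weights (tl w) = (s', t')" by fastforce
  have pos: "0 < s" "0 < t" "0 < s'" "0 < t'"
    using mediant_weights_coprime st st' by blast+
  show ?case using Cons.prems pos st st' Cons.IH[of "tl w"]
    by (cases w rule: mediant_weights.cases; cases x) auto
qed

lemma farey_middle_reduced:
  assumes "middle (farey_tree w) = (p, q)"
  shows "0 < p" "p < q" "coprime p q"
proof -
  obtain s t where st: "mediant_weights w = (s, t)" by fastforce
  then have "p = t" "q = s + t" using assms by (simp_all add: middle_farey_tree)
  then show "0 < p" "p < q" "coprime p q" using mediant_weights_coprime[OF st]
    by (simp_all add: coprime_iff_gcd_eq_1 gcd.commute[of t])
qed

lemma farey_middle_ex1:
  assumes "0 < p" "p < q" "coprime p q"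
  shows "\<exists>!w. middle (farey_tree w) = (p, q)"
proof -
  have "coprime (q - p) p" using assms
    by (metis coprime_iff_gcd_eq_1 gcd.commute gcd_diff1_nat less_imp_le)
  then obtain w where w: "mediant_weights w = (q - p, p)"
    using mediant_weights_surj[of "q - p" p] assms by auto
  show ?thesis
  proof
    show "middle (farey_tree w) = (p, q)" using w assms by (simp add: middle_farey_tree)
    fix v assume "middle (farey_tree v) = (p, q)"
    then have "mediant_weights v = (q - p, p)"
      by (auto simp: middle_farey_tree split: prod.splits)
    then show "v = w" using w mediant_weights_inj by metis
  qed
qed

lemma markov_num_eq:
  assumes "middle (farey_tree w) = (p, q)"
  shows "markov_num p q = middle (markov_tree w)"
proof -
  have "(THE w. middle (farey_tree w) = (p, q)) = w"
    using farey_middle_ex1[OF farey_middle_reduced[OF assms]] assms by (rule the1_equality)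
  then show ?thesis using farey_middle_reduced[OF assms] by (auto simp: markov_num_def)
qed

lemma markov_tree_equation:
  "case markov_tree w of (x, y, z) \<Rightarrow> x\<^sup>2 + y\<^sup>2 + z\<^sup>2 = 3 * x * y * z"
proof (induction w rule: rev_induct)
  case Nil
  then show ?case by (simp add: markov_tree_def)
next
  case (snoc t w)
  obtain x y z where v: "markov_tree w = (x, y, z)" by (metis prod_cases3)
  then have "markov_tree (w @ [t]) = markov_child (x, y, z) t" by (simp add: markov_tree_def)
  with snoc v show ?case
    by (cases t) (simp_all add: power2_eq_square algebra_simps)
qed

lemma markov_num_1_2: "markov_num 1 2 = 5"
  by (subst markov_num_eq[of "[]"]) (simp_all add: farey_tree_def markov_tree_def middle_def)

lemma markov_num_1_3: "markov_num 1 3 = 13"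
  by (subst markov_num_eq[of "[L]"]) (simp_all add: farey_tree_def markov_tree_def middle_def)

lemma markov_num_2_3: "markov_num 2 3 = 29"
  by (subst markov_num_eq[of "[R]"]) (simp_all add: farey_tree_def markov_tree_def middle_def)

end

theory Submission
  imports Defs
begin

text \<open>Put \<open>t(v) = 3 m(v) = 2 cosh N(v)\<close> for a primitive vector \<open>v = (q, p)\<close>; geometrically \<open>2 N(v)\<close>
  is the length of a simple closed geodesic on the modular torus, and \<open>N\<close> is the restriction of a
  norm. Elementarily, along \<open>b + n a\<close> with \<open>a, b\<close> a basis, \<open>t(b + n a) = c \<lambda>^n + d \<lambda>^(-n)\<close> with
  \<open>\<lambda> = exp (N a)\<close>, and Markov's equation says \<open>c d = t(a)^2 / (t(a)^2 - 4) > 1\<close>. Since \<open>ln c\<close> and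
  \<open>ln d\<close> are the one-sided derivatives of \<open>N\<close> at \<open>a\<close> in the directions \<open>b\<close> and \<open>-b\<close>, this is
  convexity of \<open>N\<close> across the ray of \<open>a\<close>. Hence every Farey vector \<open>u\<close> carries a linear functional
  that is below \<open>N\<close> and equals \<open>N\<close> at \<open>u\<close>. Comparing its value at \<open>u\<close> with those at \<open>p (1, 1)\<close> and
  \<open>q (1, 0)\<close> shows that it increases with \<open>q\<close> and with \<open>p\<close>.\<close>

section \<open>The length function and its one-sided derivatives\<close>

text \<open>For X > 2, the eigenvalue above 1 of a determinant-one matrix with trace X; thus
  \<open>len X\<close> is arcosh (X / 2).\<close>

definition eigenval :: "real \<Rightarrow> real" where
  "eigenval X = (X + sqrt (X\<^sup>2 - 4)) / 2"

definition len :: "real \<Rightarrow> real" where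
  "len X = ln (eigenval X)"

text \<open>With \<open>X = t(a)\<close>, \<open>Y = t(a + b)\<close>, \<open>Z = t(b)\<close>, the coefficient \<open>c\<close> in
  \<open>t(b + n a) = c \<lambda>^n + d \<lambda>^(-n)\<close>; as \<open>t(b - a) = X * Z - Y\<close>, \<open>d\<close> is
  \<open>growth_coeff X (X * Z - Y) Z\<close>.\<close>

definition growth_coeff :: "real \<Rightarrow> real \<Rightarrow> real \<Rightarrow> real" where
  "growth_coeff X Y Z = Z / 2 + (2 * Y - X * Z) / (2 * sqrt (X\<^sup>2 - 4))"

text \<open>The limit of N(b + n a) - n N(a). As t(b) = t(-b), only the middle argument tells the
  direction b from -b.\<close>

definition dlen :: "real \<Rightarrow> real \<Rightarrow> real \<Rightarrow> real" where
  "dlen X Y Z = ln (growth_coeff X Y Z)"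

definition trace_triple :: "real \<Rightarrow> real \<Rightarrow> real \<Rightarrow> bool" where
  "trace_triple X Y Z \<longleftrightarrow> 0 < X \<and> 0 < Y \<and> 0 < Z \<and> X\<^sup>2 + Y\<^sup>2 + Z\<^sup>2 = X * Y * Z"

lemma trace_triple_perm:
  assumes "trace_triple X Y Z"
  shows "trace_triple Y Z X" "trace_triple Z Y X" "trace_triple Y X Z" "trace_triple X Z Y"
  using assms by (auto simp: trace_triple_def algebra_simps)

lemma trace_triple_gt_2:
  assumes "trace_triple X Y Z"
  shows "2 < X"
proof (rule ccontr)
  assume "\<not> 2 < X"
  then have "X * (Y * Z) \<le> 2 * (Y * Z)"
    using assms by (intro mult_right_mono) (auto simp: trace_triple_def)
  moreover have "2 * (Y * Z) \<le> Y\<^sup>2 + Z\<^sup>2"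
    using sum_squares_bound[of Y Z] by simp
  moreover have "0 < X\<^sup>2"
    using assms by (simp add: trace_triple_def)
  moreover have "X\<^sup>2 + Y\<^sup>2 + Z\<^sup>2 = X * (Y * Z)"
    using assms by (simp add: trace_triple_def mult.assoc)
  ultimately show False
    by linarith
qed

text \<open>Vieta: Y and X * Z - Y are the roots of one quadratic, with product X^2 + Z^2 >
  0.\<close>

lemma trace_triple_flip:
  assumes "trace_triple X Y Z"
  shows "trace_triple X (X * Z - Y) Z"
proof -
  have "Y * (X * Z - Y) = X\<^sup>2 + Z\<^sup>2"
    using assms by (simp add: trace_triple_def algebra_simps power2_eq_square)
  moreover have "0 < X\<^sup>2 + Z\<^sup>2"
    using assms by (simp add: trace_triple_def add_pos_pos)
  ultimately have "0 < X * Z - Y"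
    using assms by (metis trace_triple_def zero_less_mult_pos)
  then show ?thesis
    using assms by (simp add: trace_triple_def power2_eq_square algebra_simps)
qed

lemma trace_triple_child:
  assumes "trace_triple X Y Z"
  shows "trace_triple X (X * Y - Z) Y" "trace_triple Y (Y * Z - X) Z"
  using trace_triple_flip[of X Z Y] trace_triple_flip[of Y X Z] trace_triple_perm[OF assms]
  by auto

lemma sqrt_disc:
  assumes "(2::real) < X"
  shows "0 < sqrt (X\<^sup>2 - 4)" "(sqrt (X\<^sup>2 - 4))\<^sup>2 = X\<^sup>2 - 4"
proof -
  have "2\<^sup>2 < X\<^sup>2"
    using assms by (intro power_strict_mono) auto
  then show "0 < sqrt (X\<^sup>2 - 4)" "(sqrt (X\<^sup>2 - 4))\<^sup>2 = X\<^sup>2 - 4"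
    by auto
qed

lemma eigenval_pos:
  assumes "2 < X"
  shows "0 < eigenval X"
  unfolding eigenval_def using assms by (intro half_gt_zero add_pos_pos sqrt_disc(1)) auto

lemma len_mono:
  assumes "2 < X" "X \<le> Y"
  shows "len X \<le> len Y"
proof -
  have "X\<^sup>2 \<le> Y\<^sup>2"
    using assms by (intro power_mono) auto
  then have "eigenval X \<le> eigenval Y"
    using assms by (simp add: eigenval_def add_mono)
  then show ?thesis
    using eigenval_pos[OF assms(1)] by (simp add: len_def)
qed

lemma growth_coeff_sum: "growth_coeff X Y Z + growth_coeff X (X * Z - Y) Z = Z"
  by (simp add: growth_coeff_def flip: add_divide_distrib)

lemma growth_coeff_mult_gt_1:
  assumes "trace_triple X Y Z"
  shows "1 < growth_coeff X Y Z * growth_coeff X (X * Z - Y) Z"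
proof -
  define r where "r = sqrt (X\<^sup>2 - 4)"
  have r: "0 < r" "r\<^sup>2 = X\<^sup>2 - 4"
    using sqrt_disc trace_triple_gt_2[OF assms] by (auto simp: r_def)
  \<comment> \<open>Markov's equation is quadratic in Y; both sides are its discriminant.\<close>
  have "(2 * Y - X * Z)\<^sup>2 = r\<^sup>2 * Z\<^sup>2 - 4 * X\<^sup>2"
    using assms unfolding trace_triple_def r(2) by algebra
  moreover have "growth_coeff X Y Z * growth_coeff X (X * Z - Y) Z
      = (r\<^sup>2 * Z\<^sup>2 - (2 * Y - X * Z)\<^sup>2) / (4 * r\<^sup>2)"
    using r(1) unfolding growth_coeff_def r_def[symmetric]
    by (simp add: field_simps power2_eq_square)
  ultimately have "growth_coeff X Y Z * growth_coeff X (X * Z - Y) Z = X\<^sup>2 / r\<^sup>2"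
    by simp
  also have "1 < \<dots>"
    using zero_less_power[OF r(1), of 2] r(2) by (simp add: less_divide_eq)
  finally show ?thesis .
qed

lemma growth_coeff_pos:
  assumes "trace_triple X Y Z"
  shows "0 < growth_coeff X Y Z"
proof (rule ccontr)
  assume "\<not> 0 < growth_coeff X Y Z"
  moreover have "0 < Z"
    using assms by (simp add: trace_triple_def)
  ultimately have "growth_coeff X Y Z * growth_coeff X (X * Z - Y) Z \<le> 0"
    using growth_coeff_sum[of X Y Z] by (intro mult_nonpos_nonneg) auto
  then show False
    using growth_coeff_mult_gt_1[OF assms] by simp
qed

lemma dlen_convex:
  assumes "trace_triple X Y Z"
  shows "0 \<le> dlen X Y Z + dlen X (X * Z - Y) Z"
proof -
  have "0 \<le> ln (growth_coeff X Y Z * growth_coeff X (X * Z - Y) Z)"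
    using growth_coeff_mult_gt_1[OF assms] by simp
  then show ?thesis
    using growth_coeff_pos[OF assms] growth_coeff_pos[OF trace_triple_flip[OF assms]]
    by (simp add: dlen_def ln_mult)
qed

text \<open>For a norm this is subadditivity. Here c * (Z - c) > 1 puts c between the roots of u^2 -
  Z u + 1, the larger of which is \<open>eigenval Z\<close>.\<close>

lemma dlen_le_len:
  assumes "trace_triple X Y Z"
  shows "dlen X Y Z \<le> len Z"
proof -
  define r where "r = sqrt (Z\<^sup>2 - 4)"
  define c where "c = growth_coeff X Y Z"
  have Z: "2 < Z"
    using trace_triple_gt_2 trace_triple_perm assms by blast
  have r: "0 < r" "r\<^sup>2 = Z\<^sup>2 - 4"
    using sqrt_disc[OF Z] by (auto simp: r_def)
  have "1 < c * (Z - c)"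
    using growth_coeff_mult_gt_1[OF assms] growth_coeff_sum[of X Y Z] unfolding c_def
    by (metis add_diff_cancel_left')
  then have "(2 * c - Z)\<^sup>2 \<le> r\<^sup>2"
    unfolding r(2) by (simp add: power2_eq_square algebra_simps)
  then have "2 * c - Z \<le> r"
    using r(1) power2_le_imp_le by fastforce
  then have "c \<le> eigenval Z"
    by (simp add: eigenval_def r_def)
  then show ?thesis
    using growth_coeff_pos[OF assms] by (simp add: dlen_def len_def c_def)
qed

text \<open>Replacing b by a + b shifts n by one, which multiplies c by \<lambda>.\<close>

lemma dlen_shift:
  assumes "trace_triple X Y Z"
  shows "dlen X (X * Y - Z) Y = dlen X Y Z + len X"
proof -
  define r where "r = sqrt (X\<^sup>2 - 4)"
  have X: "2 < X"
    by (rule trace_triple_gt_2[OF assms])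
  have r: "0 < r" "r\<^sup>2 = X\<^sup>2 - 4"
    using sqrt_disc[OF X] by (auto simp: r_def)
  have "eigenval X * growth_coeff X Y Z
      = Y / 2 + (r\<^sup>2 * Z + 2 * X * Y - X\<^sup>2 * Z) / (4 * r)"
    using r(1) unfolding eigenval_def growth_coeff_def r_def[symmetric]
    by (simp add: field_simps power2_eq_square)
  also have "\<dots> = growth_coeff X (X * Y - Z) Y"
    using r(1) unfolding growth_coeff_def r_def[symmetric] r(2)
    by (simp add: field_simps)
  finally have "growth_coeff X (X * Y - Z) Y = eigenval X * growth_coeff X Y Z"
    by simp
  then show ?thesis
    using growth_coeff_pos[OF assms] eigenval_pos[OF X] by (simp add: dlen_def len_def ln_mult)
qed

lemma dlen_le_len_diff:
  assumes "trace_triple X Y Z"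
  shows "dlen X Y Z \<le> len Y - len X"
  using dlen_shift[OF assms] dlen_le_len[OF trace_triple_child(1)[OF assms]] by simp

text \<open>Both sides are compared with the difference quotient \<open>N(a + b) - N(a)\<close>.\<close>

lemma dlen_mono:
  assumes "trace_triple X Y Z"
  shows "dlen X Y Z \<le> dlen Y (Y * Z - X) Z"
proof -
  have "dlen X Y Z \<le> len Y - len X"
    by (rule dlen_le_len_diff[OF assms])
  \<comment> \<open>As (a + b) - b = a, this is the derivative at a + b in the direction -b.\<close>
  moreover have "dlen Y X Z \<le> len X - len Y"
    by (rule dlen_le_len_diff) (rule trace_triple_perm[OF assms])
  moreover have "0 \<le> dlen Y X Z + dlen Y (Y * Z - X) Z"
    by (rule dlen_convex) (rule trace_triple_perm[OF assms])
  ultimately show ?thesis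
    by linarith
qed

section \<open>Supporting functionals\<close>

text \<open>Below a vertex with outer vectors \<open>a\<close> and \<open>b\<close>, the position \<open>w\<close> carries the vector
  \<open>s a + t b\<close> with \<open>(s, t) = mediant_weights w\<close>; a linear functional is given by its values
  \<open>A\<close> at \<open>a\<close> and \<open>B\<close> at \<open>b\<close>.\<close>

definition functional :: "real \<Rightarrow> real \<Rightarrow> turn list \<Rightarrow> real" where
  "functional A B w = (case mediant_weights w of (s, t) \<Rightarrow> real s * A + real t * B)"

lemma functional_simps [simp]:
  "functional A B [] = A + B"
  "functional A B (L # w) = functional A (A + B) w"
  "functional A B (R # w) = functional (A + B) B w"
  by (simp_all add: functional_def algebra_simps split: prod.splits)

definition node_len :: "int \<Rightarrow> int \<Rightarrow> int \<Rightarrow> turn list \<Rightarrow> real" where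
  "node_len x y z w = len (3 * real_of_int (middle (foldl markov_child (x, y, z) w)))"

lemma node_len_simps [simp]:
  "node_len x y z [] = len (3 * y)"
  "node_len x y z (L # w) = node_len x (3 * x * y - z) y w"
  "node_len x y z (R # w) = node_len y (3 * y * z - x) z w"
  by (simp_all add: node_len_def middle_def)

definition markov_triple :: "int \<Rightarrow> int \<Rightarrow> int \<Rightarrow> bool" where
  "markov_triple x y z \<longleftrightarrow> trace_triple (3 * x) (3 * y) (3 * z)"

lemma markov_triple_child:
  assumes "markov_triple x y z"
  shows "markov_triple x (3 * x * y - z) y" "markov_triple y (3 * y * z - x) z"
  using trace_triple_child assms by (fastforce simp: markov_triple_def algebra_simps)+

text \<open>A convex function lies above its tangent at a. A left turn keeps a and uses
  \<open>dlen_shift\<close>; a right turn moves the base point to a + b and uses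
  \<open>dlen_mono\<close>.\<close>

lemma functional_le_node_len_right:
  assumes "markov_triple x y z" "A \<le> len (3 * x)" "B \<le> dlen (3 * x) (3 * y) (3 * z)"
  shows "functional A B w \<le> node_len x y z w"
  using assms
proof (induction w arbitrary: x y z A B)
  case Nil
  then show ?case
    using dlen_le_len_diff[of "3 * x" "3 * y" "3 * z"] by (simp add: markov_triple_def)
next
  case (Cons d w)
  have tr: "trace_triple (3 * x) (3 * y) (3 * z)"
    using Cons.prems by (simp add: markov_triple_def)
  show ?case
  proof (cases d)
    case L
    have "A + B \<le> dlen (3 * x) (3 * real_of_int (3 * x * y - z)) (3 * y)"
      using Cons.prems dlen_shift[OF tr] by (simp add: algebra_simps)
    then show ?thesis
      using Cons.IH[OF markov_triple_child(1)] Cons.prems by (simp add: L)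
  next
    case R
    have "A + B \<le> len (3 * y)"
      using dlen_le_len_diff[OF tr] Cons.prems by simp
    moreover have "B \<le> dlen (3 * y) (3 * real_of_int (3 * y * z - x)) (3 * z)"
      using Cons.prems dlen_mono[OF tr] by (simp add: algebra_simps)
    ultimately show ?thesis
      using Cons.IH[OF markov_triple_child(2)] Cons.prems by (simp add: R)
  qed
qed

text \<open>The mirror image, with the tangent at b.\<close>

lemma functional_le_node_len_left:
  assumes "markov_triple x y z" "A \<le> dlen (3 * z) (3 * y) (3 * x)" "B \<le> len (3 * z)"
  shows "functional A B w \<le> node_len x y z w"
  using assms
proof (induction w arbitrary: x y z A B)
  case Nil
  then show ?case
    using dlen_le_len_diff[OF trace_triple_perm(2)[of "3 * x" "3 * y" "3 * z"]]
    by (simp add: markov_triple_def)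
next
  case (Cons d w)
  have tr: "trace_triple (3 * z) (3 * y) (3 * x)"
    using Cons.prems(1) trace_triple_perm(2)[of "3 * x" "3 * y" "3 * z"]
    by (simp add: markov_triple_def)
  show ?case
  proof (cases d)
    case L
    have "A + B \<le> len (3 * y)"
      using dlen_le_len_diff[OF tr] Cons.prems by simp
    moreover have "A \<le> dlen (3 * y) (3 * real_of_int (3 * x * y - z)) (3 * x)"
      using Cons.prems dlen_mono[OF tr] by (simp add: algebra_simps)
    ultimately show ?thesis
      using Cons.IH[OF markov_triple_child(1)] Cons.prems by (simp add: L)
  next
    case R
    have "A + B \<le> dlen (3 * z) (3 * real_of_int (3 * y * z - x)) (3 * y)"
      using Cons.prems dlen_shift[OF tr] by (simp add: algebra_simps)
    then show ?thesis
      using Cons.IH[OF markov_triple_child(2)] Cons.prems by (simp add: R)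
  qed
qed

text \<open>The last two conditions say that the functional stays below \<open>N\<close> just outside the cone
  spanned by \<open>a\<close> and \<open>b\<close>, which carries the induction over to the sibling subtree.\<close>

lemma supporting_functional:
  assumes "markov_triple x y z"
  shows "\<exists>A B. functional A B v = node_len x y z v \<and>
    (\<forall>w. functional A B w \<le> node_len x y z w) \<and>
    A \<le> len (3 * x) \<and> B \<le> len (3 * z) \<and>
    - B \<le> dlen (3 * x) (3 * real_of_int (3 * x * z - y)) (3 * z) \<and>
    - A \<le> dlen (3 * z) (3 * real_of_int (3 * x * z - y)) (3 * x)"
  using assms
proof (induction v arbitrary: x y z)
  case Nil
  define X Y Z where XYZ: "X = 3 * real_of_int x" "Y = 3 * real_of_int y" "Z = 3 * real_of_int z"
  have tr: "trace_triple X Y Z"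
    using Nil by (simp add: markov_triple_def XYZ)
  note perm = trace_triple_perm[OF tr]
  \<comment> \<open>Here u = a + b: B is the derivative of N at u in the direction b, and A makes
    the functional equal N at u. Then -A is the derivative in the direction -a.\<close>
  define B where "B = dlen Y (Y * Z - X) Z"
  define A where "A = len Y - B"
  have shift: "B = dlen Y Z X + len Y"
    using dlen_shift[OF perm(1)] by (simp add: B_def)
  have A_le: "A \<le> dlen Y (X * Y - Z) X"
    using dlen_convex[OF perm(1)] shift by (simp add: A_def mult.commute)
  have w: "functional A B w \<le> node_len x y z w" for w
  proof (cases w)
    case Nil
    then show ?thesis by (simp add: A_def XYZ)
  next
    case (Cons d w')
    show ?thesis
    proof (cases d)
      case L
      show ?thesis
        using functional_le_node_len_left[OF markov_triple_child(1)[OF Nil.prems], of A "A + B" w'] A_le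
        by (simp add: L Cons A_def XYZ algebra_simps)
    next
      case R
      show ?thesis
        using functional_le_node_len_right[OF markov_triple_child(2)[OF Nil.prems], of "A + B" B w']
        by (simp add: R Cons A_def B_def XYZ algebra_simps)
    qed
  qed
  have "A \<le> len X"
    using A_le dlen_le_len[OF trace_triple_child(2)[OF perm(2)]] by (simp add: mult.commute)
  moreover have "B \<le> len Z"
    using dlen_le_len[OF trace_triple_child(2)[OF tr]] by (simp add: B_def)
  moreover have "- B \<le> dlen X (X * Z - Y) Z"
    using dlen_mono[OF tr] dlen_convex[OF tr] by (simp add: B_def)
  moreover have "- A \<le> dlen Z (X * Z - Y) X"
    using dlen_mono[OF perm(1)] shift by (simp add: A_def mult.commute)
  ultimately show ?case
    using w by (intro exI[of _ A] exI[of _ B]) (simp add: XYZ A_def algebra_simps)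
next
  case (Cons d v)
  define X Y Z where XYZ: "X = 3 * real_of_int x" "Y = 3 * real_of_int y" "Z = 3 * real_of_int z"
  have tr: "trace_triple X Y Z"
    using Cons.prems by (simp add: markov_triple_def XYZ)
  note perm = trace_triple_perm[OF tr]
  show ?case
  proof (cases d)
    case L
    obtain A B where eq: "functional A B v = node_len x (3 * x * y - z) y v"
      and le: "\<And>w. functional A B w \<le> node_len x (3 * x * y - z) y w"
      and A: "A \<le> len X" and B: "B \<le> len Y"
      and B': "- B \<le> dlen X Z Y" and A': "- A \<le> dlen Y Z X"
      using Cons.IH[OF markov_triple_child(1)[OF Cons.prems]] by (auto simp: XYZ)
    \<comment> \<open>The values A at a and B at a + b give B - A at b = (a + b) - a. This bound is
      what the sibling subtree, spanned by a + b and b, requires.\<close>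
    have diff: "B - A \<le> dlen Y (Y * Z - X) Z"
      using B A' dlen_shift[OF perm(1)] by simp
    have w: "functional A (B - A) w \<le> node_len x y z w" for w
    proof (cases w)
      case Nil
      then show ?thesis using B by (simp add: XYZ)
    next
      case (Cons e w')
      show ?thesis
        using functional_le_node_len_right[OF markov_triple_child(2)[OF \<open>markov_triple x y z\<close>], of B "B - A" w']
          B diff le[of w']
        by (cases e) (simp_all add: Cons XYZ algebra_simps)
    qed
    have "B - A \<le> len Z"
      using diff dlen_le_len[OF trace_triple_child(2)[OF tr]] by simp
    moreover have "- (B - A) \<le> dlen X (X * Z - Y) Z"
      using A B' dlen_shift[OF perm(4)] by simp
    moreover have "- A \<le> dlen Z (X * Z - Y) X"
      using A' dlen_mono[OF perm(1)] by (simp add: mult.commute)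
    ultimately show ?thesis
      using w eq A by (intro exI[of _ A] exI[of _ "B - A"]) (simp add: XYZ L algebra_simps)
  next
    case R
    obtain A B where eq: "functional A B v = node_len y (3 * y * z - x) z v"
      and le: "\<And>w. functional A B w \<le> node_len y (3 * y * z - x) z w"
      and A: "A \<le> len Y" and B: "B \<le> len Z"
      and B': "- B \<le> dlen Y X Z" and A': "- A \<le> dlen Z X Y"
      using Cons.IH[OF markov_triple_child(2)[OF Cons.prems]] by (auto simp: XYZ)
    have diff: "A - B \<le> dlen Y (X * Y - Z) X"
      using A B' dlen_shift[OF perm(3)] by (simp add: mult.commute)
    have w: "functional (A - B) B w \<le> node_len x y z w" for w
    proof (cases w)
      case Nil
      then show ?thesis using A by (simp add: XYZ)
    next
      case (Cons e w')
      show ?thesis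
        using functional_le_node_len_left[OF markov_triple_child(1)[OF \<open>markov_triple x y z\<close>], of "A - B" A w']
          A diff le[of w']
        by (cases e) (simp_all add: Cons XYZ algebra_simps)
    qed
    have "A - B \<le> len X"
      using diff dlen_le_len[OF trace_triple_child(2)[OF perm(2)]] by (simp add: mult.commute)
    moreover have "- (A - B) \<le> dlen Z (X * Z - Y) X"
      using B A' dlen_shift[OF trace_triple_perm(4)[OF perm(2)]] by (simp add: mult.commute)
    moreover have "- B \<le> dlen X (X * Z - Y) Z"
      using B' dlen_mono[OF perm(3)] by simp
    ultimately show ?thesis
      using w eq B by (intro exI[of _ "A - B"] exI[of _ B]) (simp add: XYZ R algebra_simps)
  qed
qed

section \<open>Monotonicity of Markov numbers\<close>

lemma markov_triple_root: "markov_triple 1 5 2"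
  by (simp add: markov_triple_def trace_triple_def)

text \<open>The weights are the coordinates of (q, p) in the basis (1, 0), (1, 1) belonging to 0/1
  and 1/1.\<close>

lemma node_of_fraction:
  assumes "0 < p" "p < q" "coprime p q"
  obtains w where "markov_num p q = middle (markov_tree w)"
    and "\<And>A B. functional A B w = real (q - p) * A + real p * B"
    and "node_len 1 5 2 w = len (3 * markov_num p q)"
proof -
  obtain w where w: "middle (farey_tree w) = (p, q)"
    using farey_middle_ex1[OF assms] by blast
  then have "mediant_weights w = (q - p, p)"
    by (auto simp: middle_farey_tree split: prod.splits)
  then show ?thesis
    using that[of w] markov_num_eq[OF w]
    by (simp add: functional_def node_len_def markov_tree_def)
qed

lemma markov_num_gt_0:
  assumes "0 < p" "p < q" "coprime p q"
  shows "0 < markov_num p q"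
proof -
  have "markov_triple x y z \<Longrightarrow> 0 < middle (foldl markov_child (x, y, z) w)" for x y z w
  proof (induction w arbitrary: x y z)
    case Nil
    then show ?case by (simp add: middle_def markov_triple_def trace_triple_def)
  next
    case (Cons d w)
    then show ?case using markov_triple_child[OF Cons.prems] by (cases d) auto
  qed
  from this[OF markov_triple_root] show ?thesis
    using node_of_fraction[OF assms] by (metis markov_tree_def)
qed

lemma markov_num_less_if_len_less:
  assumes "0 < p" "p < q" "coprime p q" "0 < p'" "p' < q'" "coprime p' q'"
    and "len (3 * markov_num p q) < len (3 * markov_num p' q')"
  shows "markov_num p q < markov_num p' q'"
proof (rule ccontr)
  assume "\<not> markov_num p q < markov_num p' q'"
  moreover have "2 < 3 * real_of_int (markov_num p' q')"
    using markov_num_gt_0[OF assms(4-6)] by linarith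
  ultimately have "len (3 * markov_num p' q') \<le> len (3 * markov_num p q)"
    by (intro len_mono) auto
  then show False
    using assms(7) by simp
qed

lemma markov_supporting_functional:
  assumes "0 < p" "p < q" "coprime p q"
  obtains A B where "len (3 * markov_num p q) = real (q - p) * A + real p * B"
    and "\<And>p' q'. \<lbrakk>0 < p'; p' < q'; coprime p' q'\<rbrakk>
      \<Longrightarrow> real (q' - p') * A + real p' * B \<le> len (3 * markov_num p' q')"
    and "A \<le> len 3" "B \<le> len 6"
proof -
  obtain v where v: "\<And>A B. functional A B v = real (q - p) * A + real p * B"
    "node_len 1 5 2 v = len (3 * markov_num p q)"
    using node_of_fraction[OF assms] by metis
  obtain A B where AB: "functional A B v = node_len 1 5 2 v"
    "\<And>w. functional A B w \<le> node_len 1 5 2 w" "A \<le> len 3" "B \<le> len 6"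
    using supporting_functional[OF markov_triple_root, of v] by auto
  have "real (q' - p') * A + real p' * B \<le> len (3 * markov_num p' q')"
    if "0 < p'" "p' < q'" "coprime p' q'" for p' q'
    using node_of_fraction[OF that] AB(2) by metis
  then show ?thesis
    using that[of A B] AB v by simp
qed

text \<open>N(q, p) > p N(1, 1): by the tangent at (1, 1), whose slope \<open>dlen 6 15 3\<close> in
  the direction (1, 0) is positive.\<close>

lemma len_markov_num_gt_numerator:
  assumes "0 < p" "p < q" "coprime p q"
  shows "real p * len 6 < len (3 * markov_num p q)"
proof -
  obtain w where w: "\<And>A B. functional A B w = real (q - p) * A + real p * B"
    "node_len 1 5 2 w = len (3 * markov_num p q)"
    using node_of_fraction[OF assms] by metis
  have "0 < 6 / sqrt (32::real)"
    by simp
  then have "1 < 3 / 2 + 6 / sqrt (32::real)"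
    by linarith
  then have "1 < growth_coeff 6 15 3"
    by (simp add: growth_coeff_def)
  then have "0 < dlen 6 15 3"
    by (simp add: dlen_def)
  moreover have "real (q - p) * dlen 6 15 3 + real p * len 6 \<le> len (3 * markov_num p q)"
    using functional_le_node_len_left[OF markov_triple_root, of "dlen 6 15 3" "len 6" w]
    by (simp add: w)
  ultimately show ?thesis
    using assms by (smt (verit) mult_pos_pos of_nat_0_less_iff zero_less_diff)
qed

text \<open>N(q, p) > q N(1, 0): by the tangent at (1, 0), whose slope in the direction (1, 1)
  exceeds \<open>len 3\<close>, so that its slope along (0, 1) is positive.\<close>

lemma len_markov_num_gt_denominator:
  assumes "0 < p" "p < q" "coprime p q"
  shows "real q * len 3 < len (3 * markov_num p q)"
proof -
  obtain w where w: "\<And>A B. functional A B w = real (q - p) * A + real p * B"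
    "node_len 1 5 2 w = len (3 * markov_num p q)"
    using node_of_fraction[OF assms] by metis
  have "eigenval 3 < growth_coeff 3 15 6"
  proof -
    have "sqrt 5 < (3::real)"
      by (rule real_less_lsqrt) auto
    moreover have "0 < 12 / sqrt (5::real)"
      by simp
    ultimately have "sqrt 5 < 3 + 12 / sqrt (5::real)"
      by linarith
    then show ?thesis
      by (simp add: eigenval_def growth_coeff_def)
  qed
  then have "len 3 < dlen 3 15 6"
    using eigenval_pos[of 3] by (simp add: dlen_def len_def)
  moreover have "real (q - p) * len 3 + real p * dlen 3 15 6 \<le> len (3 * markov_num p q)"
    using functional_le_node_len_right[OF markov_triple_root, of "len 3" "dlen 3 15 6" w]
    by (simp add: w)
  moreover have "real q * len 3 = real (q - p) * len 3 + real p * len 3"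
    using assms by (simp add: of_nat_diff algebra_simps)
  ultimately show ?thesis
    using assms by (smt (verit) mult_strict_left_mono of_nat_0_less_iff)
qed

theorem markov_num_strict_mono_denominator:
  assumes "0 < p" "p < q" "0 < i" "coprime p q" "coprime p (q + i)"
  shows "markov_num p q < markov_num p (q + i)"
proof -
  obtain A B where AB: "len (3 * markov_num p q) = real (q - p) * A + real p * B"
    "real (q + i - p) * A + real p * B \<le> len (3 * markov_num p (q + i))" "B \<le> len 6"
    using markov_supporting_functional[OF assms(1,2,4)] assms by (metis trans_less_add1)
  have "real p * B \<le> real p * len 6"
    using AB(3) by (simp add: mult_left_mono)
  \<comment> \<open>The functional is larger at (q, p) than at p (1, 1), so its value A at (1, 0) is
    positive.\<close>
  then have "0 < real (q - p) * A"
    using len_markov_num_gt_numerator[OF assms(1,2,4)] AB(1) by linarith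
  then have "0 < real i * A"
    using assms by (simp add: zero_less_mult_iff)
  moreover have "real (q + i - p) * A = real (q - p) * A + real i * A"
    using assms by (simp add: of_nat_diff algebra_simps)
  ultimately have "len (3 * markov_num p q) < len (3 * markov_num p (q + i))"
    using AB by linarith
  then show ?thesis
    using assms by (intro markov_num_less_if_len_less) auto
qed

theorem markov_num_strict_mono_numerator:
  assumes "0 < p" "p + i < q" "0 < i" "coprime p q" "coprime (p + i) q"
  shows "markov_num p q < markov_num (p + i) q"
proof -
  have pq: "p < q"
    using assms by simp
  obtain A B where AB: "len (3 * markov_num p q) = real (q - p) * A + real p * B"
    "real (q - (p + i)) * A + real (p + i) * B \<le> len (3 * markov_num (p + i) q)" "A \<le> len 3"
    using markov_supporting_functional[OF assms(1) pq assms(4)] assms by (metis trans_less_add1)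
  have "real q * A \<le> real q * len 3"
    using AB(3) by (simp add: mult_left_mono)
  moreover have "real (q - p) * A + real p * B = real q * A + real p * (B - A)"
    using pq by (simp add: of_nat_diff algebra_simps)
  \<comment> \<open>B - A is the value at (0, 1), the slope in p.\<close>
  ultimately have "0 < real p * (B - A)"
    using len_markov_num_gt_denominator[OF assms(1) pq assms(4)] AB(1) by linarith
  then have "0 < real i * (B - A)"
    using assms by (simp add: zero_less_mult_iff)
  moreover have "real (q - (p + i)) * A + real (p + i) * B
      = real (q - p) * A + real p * B + real i * (B - A)"
    using assms by (simp add: of_nat_diff algebra_simps)
  ultimately have "len (3 * markov_num p q) < len (3 * markov_num (p + i) q)"
    using AB by linarith
  then show ?thesis
    using assms pq by (intro markov_num_less_if_len_less) auto
qed

theorem theorem1p5: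
  "(\<forall>p q i :: nat. 0 < p \<and> 0 < q \<and> 0 < i \<and> p < q \<and> gcd q p = 1 \<and> gcd (q + i) p = 1
      \<longrightarrow> markov_num p q < markov_num p (q + i))
   \<and>
   (\<forall>p q i :: nat. 0 < p \<and> 0 < q \<and> 0 < i \<and> p + i < q \<and> gcd q p = 1 \<and> gcd q (p + i) = 1
      \<longrightarrow> markov_num p q < markov_num (p + i) q)"
  using markov_num_strict_mono_denominator markov_num_strict_mono_numerator
  by (simp add: coprime_iff_gcd_eq_1 gcd.commute)

end
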